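(* Let $(a_n)_{n\ge0}$ be a sequence of rational numbers satisfying \[n^2a_n=(11n^2-11n+3)a_{n-1}+(n-1)^2a_{n-2}\quad\text{for all } n\ge2.\] Then $a_n\in\mathbb{Z}$ for all $n\ge0$ if and only if $(a_0,a_1)=(\alpha,3\alpha)$ for some $\alpha\in\mathbb{Z}$. *)

theory Defs imports Complex_Main
begin

end

theory Submission imports Defs begin

text \<open>
  The solution with initial values \<open>1, 3\<close> is the sequence of Apery numbers
  \<open>\<Sum>k. (n choose k)\<^sup>2 * (n + k choose k)\<close>, which are integers; the recurrence for them
  telescopes in \<open>k\<close>. Conversely, the Casoratian \<open>W n\<close> of a solution \<open>a\<close> and the Apery
  numbers satisfies \<open>(n + 1)\<^sup>2 * W n = \<plusminus> W 0\<close>. If \<open>a\<close> is integral, then \<open>W 0 = a 1 - 3 * a 0\<close>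
  is an integer divisible by every square, hence zero.
\<close>

definition apery_term :: "nat \<Rightarrow> nat \<Rightarrow> rat" where
  "apery_term n k = of_nat ((n choose k)\<^sup>2 * ((n + k) choose k))"

definition apery :: "nat \<Rightarrow> rat" where
  "apery n = (\<Sum>k\<le>n. apery_term n k)"

lemma apery_in_Ints: "apery n \<in> \<int>"
  unfolding apery_def apery_term_def by (intro Ints_sum) simp

lemma apery_0 [simp]: "apery 0 = 1"
  by (simp add: apery_def apery_term_def)

lemma apery_1 [simp]: "apery (Suc 0) = 3"
  by (simp add: apery_def apery_term_def)

lemma apery_term_0_right [simp]: "apery_term n 0 = 1"
  by (simp add: apery_term_def)

lemma apery_term_eq_0: "n < k \<Longrightarrow> apery_term n k = 0"
  by (simp add: apery_term_def)

text \<open>Padding with zero terms lets the sums for \<open>n\<close>, \<open>n + 1\<close> and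
  \<open>n + 2\<close> run over one common range.\<close>

lemma apery_eq_sum:
  assumes "n \<le> N"
  shows "apery n = (\<Sum>k\<le>N. apery_term n k)"
  unfolding apery_def using assms
  by (intro sum.mono_neutral_left) (auto intro: apery_term_eq_0)

text \<open>The difference is taken in the ring, so no assumption \<open>k \<le> n\<close> is
  needed: for \<open>k > n\<close> both binomials vanish.\<close>

lemma of_nat_Suc_times_binomial_Suc:
  "of_nat (Suc k) * of_nat (n choose Suc k) =
    (of_nat n - of_nat k :: 'a :: comm_ring_1) * of_nat (n choose k)"
proof (cases "k \<le> n")
  case True
  have "Suc k * (n choose Suc k) = (n - k) * (n choose k)"
    using binomial_absorption[of k n] binomial_absorb_comp[of n k] by simp
  then have "of_nat (Suc k * (n choose Suc k)) = (of_nat ((n - k) * (n choose k)) :: 'a)"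
    by simp
  then show ?thesis
    using True by (simp only: of_nat_mult of_nat_diff)
qed (simp add: binomial_eq_0)

text \<open>Both sides equal \<open>Suc k\<close> times \<open>Suc n choose Suc k\<close>, reduced
  once in the lower index only and once in both indices.\<close>

lemma of_nat_Suc_diff_times_Suc_binomial:
  "(of_nat (Suc n) - of_nat k :: 'a :: comm_ring_1) * of_nat (Suc n choose k) =
    of_nat (Suc n) * of_nat (n choose k)"
proof -
  have "of_nat (Suc k) * of_nat (Suc n choose Suc k) = (of_nat (Suc n) * of_nat (n choose k) :: 'a)"
    by (simp only: Suc_times_binomial flip: of_nat_mult)
  then show ?thesis
    by (simp only: of_nat_Suc_times_binomial_Suc)
qed

lemma Suc_times_binomial_add_Suc: "Suc n * (Suc n + k choose k) = (Suc n + k) * (n + k choose k)"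
proof -
  \<comment> \<open>Symmetry moves the varying index into the lower position, where absorption
    applies.\<close>
  have "Suc n + k choose k = Suc (n + k) choose Suc n" "n + k choose k = n + k choose n"
    using binomial_symmetric[of "Suc n" "Suc (n + k)"] binomial_symmetric[of n "n + k"]
    by simp_all
  then show ?thesis
    by (simp only: Suc_times_binomial add_Suc)
qed

text \<open>The squared binomial contributes two factors \<open>Suc k\<close> and the other binomial
  a third. Clearing denominators keeps the relation valid where terms vanish.\<close>

lemma apery_term_Suc_right:
  "of_nat (Suc k) ^ 3 * apery_term n (Suc k) =
    of_nat (n + k + 1) * (of_nat n - of_nat k)\<^sup>2 * apery_term n k"
proof -
  define p q r s :: rat
    where "p = of_nat (n choose Suc k)" and "q = of_nat (n choose k)"
      and "r = of_nat (Suc (n + k) choose Suc k)" and "s = of_nat (n + k choose k)"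
  have pq: "of_nat (Suc k) * p = (of_nat n - of_nat k) * q"
    unfolding p_def q_def by (rule of_nat_Suc_times_binomial_Suc)
  have rs: "of_nat (Suc k) * r = of_nat (n + k + 1) * s"
    unfolding r_def s_def by (simp only: Suc_times_binomial flip: of_nat_mult) simp
  have "of_nat (Suc k) ^ 3 * apery_term n (Suc k) = (of_nat (Suc k) * p)\<^sup>2 * (of_nat (Suc k) * r)"
    by (simp add: apery_term_def p_def r_def power2_eq_square power3_eq_cube)
  also have "\<dots> = of_nat (n + k + 1) * (of_nat n - of_nat k)\<^sup>2 * apery_term n k"
    unfolding pq rs by (simp add: apery_term_def q_def s_def power2_eq_square)
  finally show ?thesis .
qed

text \<open>The factor on the left cannot be divided out in general: at \<open>k = Suc n\<close>
  both sides are zero although \<open>apery_term (Suc n) k\<close> is not.\<close>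

lemma apery_term_Suc_left:
  "(of_nat (Suc n) - of_nat k)\<^sup>2 * apery_term (Suc n) k =
    of_nat (Suc n) * of_nat (Suc n + k) * apery_term n k"
proof -
  define p q r s :: rat
    where "p = of_nat (Suc n choose k)" and "q = of_nat (n choose k)"
      and "r = of_nat (Suc n + k choose k)" and "s = of_nat (n + k choose k)"
  have pq: "(of_nat (Suc n) - of_nat k) * p = of_nat (Suc n) * q"
    unfolding p_def q_def by (rule of_nat_Suc_diff_times_Suc_binomial)
  have rs: "of_nat (Suc n) * r = of_nat (Suc n + k) * s"
    unfolding r_def s_def by (simp only: Suc_times_binomial_add_Suc flip: of_nat_mult)
  have "(of_nat (Suc n) - of_nat k)\<^sup>2 * apery_term (Suc n) k = ((of_nat (Suc n) - of_nat k) * p)\<^sup>2 * r"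
    by (simp add: apery_term_def p_def r_def power_mult_distrib)
  also have "\<dots> = of_nat (Suc n) * q\<^sup>2 * (of_nat (Suc n) * r)"
    unfolding pq by (simp add: power2_eq_square)
  also have "\<dots> = of_nat (Suc n) * of_nat (Suc n + k) * apery_term n k"
    unfolding rs by (simp add: apery_term_def q_def s_def)
  finally show ?thesis .
qed

text \<open>A step in \<open>k\<close> followed by a step in \<open>n\<close>: the square produced
  by the first is exactly the one absorbed by the second, so nothing is divided.\<close>

lemma apery_term_Suc_Suc:
  "of_nat (Suc k) ^ 3 * apery_term (Suc n) (Suc k) =
    of_nat (Suc n) * of_nat (n + k + 2) * of_nat (n + k + 1) * apery_term n k"
proof -
  have "of_nat (Suc k) ^ 3 * apery_term (Suc n) (Suc k) =
      of_nat (n + k + 2) * ((of_nat (Suc n) - of_nat k)\<^sup>2 * apery_term (Suc n) k)"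
    unfolding apery_term_Suc_right by (simp add: mult.assoc)
  then show ?thesis
    unfolding apery_term_Suc_left by (simp add: mult_ac)
qed

text \<open>A creative telescoping certificate in the sense of Zeilberger: its differences in
  \<open>k\<close> are the recurrence, centred at \<open>n\<close>, applied to the summand.\<close>

definition apery_cert :: "nat \<Rightarrow> nat \<Rightarrow> rat" where
  "apery_cert n k = ((of_nat k)\<^sup>2 + 3 * (2 * of_nat n + 1) * of_nat k
     - 11 * (of_nat n)\<^sup>2 - 9 * of_nat n - 2) * apery_term n k"

text \<open>After multiplication by \<open>(k + 1) ^ 3\<close> every term becomes a polynomial
  multiple of \<open>apery_term (n + 1) k\<close>, which leaves a polynomial identity.\<close>

lemma apery_cert_diff:
  "(of_nat (n + 2))\<^sup>2 * apery_term (n + 2) (Suc k)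
     - (11 * (of_nat (n + 1))\<^sup>2 + 11 * of_nat (n + 1) + 3) * apery_term (n + 1) (Suc k)
     - (of_nat (n + 1))\<^sup>2 * apery_term n (Suc k)
   = apery_cert (n + 1) (Suc k) - apery_cert (n + 1) k"
proof -
  define X where "X = apery_term (n + 1) k"
  define x y :: rat where "x = of_nat n" and "y = of_nat k"
  define P Q R where "P = apery_term (n + 2) (Suc k)" and "Q = apery_term (n + 1) (Suc k)"
    and "R = apery_term n (Suc k)"
  have y1: "y + 1 \<noteq> 0"
    unfolding y_def by (metis of_nat_Suc add.commute of_nat_neq_0)
  have P: "(y + 1) ^ 3 * P = (x + 2) * (x + y + 3) * (x + y + 2) * X"
    using apery_term_Suc_Suc[of k "n + 1"]
    by (simp add: P_def X_def x_def y_def algebra_simps)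
  have Q: "(y + 1) ^ 3 * Q = (x + y + 2) * (x + 1 - y)\<^sup>2 * X"
    using apery_term_Suc_right[of k "n + 1"]
    by (simp add: Q_def X_def x_def y_def algebra_simps)
  \<comment> \<open>Eliminating \<open>apery_term n k\<close> in favour of \<open>X\<close> costs a
    factor \<open>x + 1\<close>, which the coefficient \<open>(x + 1)\<^sup>2\<close> of
    \<open>R\<close> supplies.\<close>
  have "(y + 1) ^ 3 * R = (x + y + 1) * (x - y)\<^sup>2 * apery_term n k"
    using apery_term_Suc_right[of k n] by (simp add: R_def x_def y_def algebra_simps)
  moreover have "(x + 1 - y)\<^sup>2 * X = (x + 1) * (x + y + 1) * apery_term n k"
    using apery_term_Suc_left[of n k] by (simp add: X_def x_def y_def algebra_simps)
  ultimately have R: "(x + 1) * ((y + 1) ^ 3 * R) = (x - y)\<^sup>2 * ((x + 1 - y)\<^sup>2 * X)"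
    by simp
  have "(y + 1) ^ 3 * ((x + 2)\<^sup>2 * P - (11 * (x + 1)\<^sup>2 + 11 * (x + 1) + 3) * Q - (x + 1)\<^sup>2 * R)
    = (x + 2)\<^sup>2 * ((y + 1) ^ 3 * P) - (11 * (x + 1)\<^sup>2 + 11 * (x + 1) + 3) * ((y + 1) ^ 3 * Q)
      - (x + 1) * ((x + 1) * ((y + 1) ^ 3 * R))"
    by (simp add: algebra_simps power2_eq_square)
  also have "\<dots> = ((y + 1)\<^sup>2 + 3 * (2 * (x + 1) + 1) * (y + 1) - 11 * (x + 1)\<^sup>2 - 9 * (x + 1) - 2)
        * ((y + 1) ^ 3 * Q)
      - (y + 1) ^ 3 * ((y\<^sup>2 + 3 * (2 * (x + 1) + 1) * y - 11 * (x + 1)\<^sup>2 - 9 * (x + 1) - 2) * X)"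
    unfolding P Q R by algebra
  also have "\<dots> = (y + 1) ^ 3 *
      (((y + 1)\<^sup>2 + 3 * (2 * (x + 1) + 1) * (y + 1) - 11 * (x + 1)\<^sup>2 - 9 * (x + 1) - 2) * Q
      - (y\<^sup>2 + 3 * (2 * (x + 1) + 1) * y - 11 * (x + 1)\<^sup>2 - 9 * (x + 1) - 2) * X)"
    by (simp add: algebra_simps)
  finally have "(x + 2)\<^sup>2 * P - (11 * (x + 1)\<^sup>2 + 11 * (x + 1) + 3) * Q - (x + 1)\<^sup>2 * R
    = ((y + 1)\<^sup>2 + 3 * (2 * (x + 1) + 1) * (y + 1) - 11 * (x + 1)\<^sup>2 - 9 * (x + 1) - 2) * Q
      - (y\<^sup>2 + 3 * (2 * (x + 1) + 1) * y - 11 * (x + 1)\<^sup>2 - 9 * (x + 1) - 2) * X"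
    using y1 by simp
  then show ?thesis
    by (simp add: apery_cert_def P_def Q_def R_def X_def x_def y_def add.commute)
qed

lemma apery_rec:
  "(of_nat (n + 2))\<^sup>2 * apery (n + 2) =
    (11 * (of_nat (n + 1))\<^sup>2 + 11 * of_nat (n + 1) + 3) * apery (n + 1)
    + (of_nat (n + 1))\<^sup>2 * apery n"
proof -
  let ?t = "\<lambda>k. (of_nat (n + 2))\<^sup>2 * apery_term (n + 2) k
     - (11 * (of_nat (n + 1))\<^sup>2 + 11 * of_nat (n + 1) + 3) * apery_term (n + 1) k
     - (of_nat (n + 1))\<^sup>2 * apery_term n k"
  have "(\<Sum>k\<le>N. ?t k) = apery_cert (n + 1) N" for N
  proof (induction N)
    \<comment> \<open>The constant term of the certificate polynomial equals \<open>?t 0\<close>, so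
      no boundary term arises at the lower end.\<close>
    case 0
    show ?case
      by (simp add: apery_cert_def algebra_simps power2_eq_square)
  next
    case (Suc N)
    then show ?case
      using apery_cert_diff[of n N] by simp
  qed
  \<comment> \<open>At the upper end the certificate vanishes because \<open>n + 2\<close> exceeds
    \<open>n + 1\<close>.\<close>
  from this[of "n + 2"] have "(\<Sum>k\<le>n + 2. ?t k) = 0"
    by (simp add: apery_cert_def apery_term_eq_0)
  then show ?thesis
    by (simp add: apery_eq_sum[where N = "n + 2"] sum_subtractf flip: sum_distrib_left)
qed

text \<open>A divisor of a nonzero \<open>d\<close> is at most \<open>\<bar>d\<bar>\<close> in
  absolute value, which \<open>(\<bar>d\<bar> + 1)\<^sup>2\<close> exceeds.\<close>

lemma int_eq_0_if_all_squares_dvd: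
  fixes d :: int
  assumes "\<And>n. (int (Suc n))\<^sup>2 dvd d"
  shows "d = 0"
proof (rule ccontr)
  assume "d \<noteq> 0"
  with assms[of "nat \<bar>d\<bar>"] have "\<bar>(int (Suc (nat \<bar>d\<bar>)))\<^sup>2\<bar> \<le> \<bar>d\<bar>"
    by (intro dvd_imp_le_int)
  then have "(\<bar>d\<bar> + 1)\<^sup>2 \<le> \<bar>d\<bar>"
    by (simp add: add.commute)
  moreover have "\<bar>d\<bar> < (\<bar>d\<bar> + 1)\<^sup>2"
    using self_le_power[of "\<bar>d\<bar> + 1" 2] by simp
  ultimately show False
    by linarith
qed

theorem theorem6p1:
  fixes a :: "nat \<Rightarrow> rat"
  assumes "\<forall>n\<ge>2. (of_nat n)\<^sup>2 * a n =
      (11 * (of_nat n)\<^sup>2 - 11 * of_nat n + 3) * a (n - 1) + (of_nat n - 1)\<^sup>2 * a (n - 2)"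
  shows "(\<forall>n. a n \<in> \<int>) \<longleftrightarrow> (\<exists>\<alpha>\<in>\<int>. (a 0, a 1) = (\<alpha>, 3 * \<alpha>))"
proof
  have rec: "(of_nat (n + 2))\<^sup>2 * a (n + 2) =
      (11 * (of_nat (n + 1))\<^sup>2 + 11 * of_nat (n + 1) + 3) * a (n + 1)
      + (of_nat (n + 1))\<^sup>2 * a n" for n
    using assms[rule_format, of "n + 2"] by (simp add: algebra_simps power2_eq_square)
  {
    assume int: "\<forall>n. a n \<in> \<int>"
    define W where "W n = a (Suc n) * apery n - a n * apery (Suc n)" for n
    \<comment> \<open>The middle terms of the two recurrences cancel; the trailing terms leave
      \<open>W n\<close> with its two products exchanged, hence the sign.\<close>
    have W_Suc: "(of_nat (n + 2))\<^sup>2 * W (Suc n) = - ((of_nat (n + 1))\<^sup>2 * W n)" for n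
    proof -
      have "(of_nat (n + 2))\<^sup>2 * W (Suc n) =
          ((of_nat (n + 2))\<^sup>2 * a (n + 2)) * apery (n + 1)
          - a (n + 1) * ((of_nat (n + 2))\<^sup>2 * apery (n + 2))"
        by (simp add: W_def right_diff_distrib mult.assoc mult.left_commute)
      also have "\<dots> = - ((of_nat (n + 1))\<^sup>2 * W n)"
        unfolding rec apery_rec by (simp add: W_def algebra_simps)
      finally show ?thesis .
    qed
    have W: "W 0 = (-1) ^ n * ((of_nat (Suc n))\<^sup>2 * W n)" for n
    proof (induction n)
      case (Suc n)
      then show ?case
        using W_Suc[of n] by simp
    qed simp
    have W_int: "W n \<in> \<int>" for n
      unfolding W_def using int apery_in_Ints by (intro Ints_diff Ints_mult) auto
    obtain d where d: "W 0 = of_int d"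
      using W_int Ints_cases by blast
    have "(int (Suc n))\<^sup>2 dvd d" for n
    proof -
      obtain w where w: "W n = of_int w"
        using W_int Ints_cases by blast
      have "(of_int d :: rat) = of_int ((-1) ^ n * ((int (Suc n))\<^sup>2 * w))"
        using W[of n] unfolding d w by simp
      then have "d = (-1) ^ n * ((int (Suc n))\<^sup>2 * w)"
        by (simp only: of_int_eq_iff)
      then show ?thesis by simp
    qed
    then have "d = 0"
      by (rule int_eq_0_if_all_squares_dvd)
    \<comment> \<open>The initial values \<open>1\<close> and \<open>3\<close> of
      \<open>apery\<close> give \<open>W 0 = a 1 - 3 * a 0\<close>.\<close>
    with d have "a 1 = 3 * a 0"
      by (simp add: W_def)
    with int show "\<exists>\<alpha>\<in>\<int>. (a 0, a 1) = (\<alpha>, 3 * \<alpha>)"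
      by auto
  next
    assume "\<exists>\<alpha>\<in>\<int>. (a 0, a 1) = (\<alpha>, 3 * \<alpha>)"
    then obtain \<alpha> where \<alpha>: "\<alpha> \<in> \<int>" "a 0 = \<alpha>" "a 1 = 3 * \<alpha>"
      by auto
    \<comment> \<open>The recurrence has order two, so the induction carries two consecutive
      values.\<close>
    have "a n = \<alpha> * apery n \<and> a (Suc n) = \<alpha> * apery (Suc n)" for n
    proof (induction n)
      case 0
      show ?case using \<alpha> by simp
    next
      case (Suc n)
      have "(of_nat (n + 2))\<^sup>2 * a (n + 2) = \<alpha> * ((of_nat (n + 2))\<^sup>2 * apery (n + 2))"
        unfolding rec apery_rec using Suc by (simp add: algebra_simps)
      then have "(of_nat (n + 2))\<^sup>2 * a (n + 2) = (of_nat (n + 2))\<^sup>2 * (\<alpha> * apery (n + 2))"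
        by (simp only: mult.left_commute)
      moreover have "(of_nat (n + 2) :: rat) \<noteq> 0"
        by (metis add_2_eq_Suc' of_nat_neq_0)
      ultimately have "a (n + 2) = \<alpha> * apery (n + 2)"
        by (metis mult_left_cancel power_not_zero)
      with Suc show ?case by simp
    qed
    then show "\<forall>n. a n \<in> \<int>"
      using \<alpha> apery_in_Ints by simp
  }
qed

end
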